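(* Let $d=1$. Assume that the distribution of $R_1$ has a probability density $p$ on $(0,\infty)$ with $p(z)\approx z^{\alpha-1}$ for $z\to 0$, for some $\alpha>0$. Then $$\mathbb{P}[K\ge n]=\exp\big(-(1+\alpha)\,n\log n\cdot(1+o(1))\big),\qquad n\to\infty.$$
   Context: Setting: $d=1$, balls are closed intervals $B(x,r)=[x-r,x+r]$. Let $(\xi_i)_{i\ge1}$ be i.i.d. uniform on $[0,1]$, $(R_i)_{i\ge1}$ i.i.d. positive random variables, $N$ a Poisson random variable with parameter $\lambda>0$; the families $(\xi_i)$, $(R_i)$ and $N$ are independent. Define the random set $S:=\bigcup_{i=1}^N B(\xi_i,R_i)\cap[0,1]$ and $$K:=\min\Big\{r\ge1 \;\Big|\; \exists\, i_1,\dots,i_r\in\{1,\dots,N\}:\ S=\bigcup_{s=1}^r B(\xi_{i_s},R_{i_s})\cap[0,1]\Big\},$$ with $K:=0$ if $N=0$. Notation: $p(z)\approx q(z)$ as $z\to0$ means that $p(z)/q(z)$ is bounded away from zero and infinity for all sufficiently small $z>0$. A relation $f(n)=\exp(-a\,n\log n\cdot(1+o(1)))$ (resp. $\le$, $\ge$) means there is a sequence $\varepsilon_n\to0$ with $f(n)=\exp(-a\,n\log n\,(1+\varepsilon_n))$ (resp. $\le$, $\ge$) for all large $n$. *)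

theory Defs
  imports "HOL-Probability.Probability"
begin

definition approx_at_zero :: "(real \<Rightarrow> real) \<Rightarrow> (real \<Rightarrow> real) \<Rightarrow> bool" where
  "approx_at_zero p q \<longleftrightarrow>
     (\<exists>c C. c > 0 \<and> (\<forall>\<^sub>F z in at_right 0. c \<le> p z / q z \<and> p z / q z \<le> C))"

definition ball_union :: "(nat \<Rightarrow> real) \<Rightarrow> (nat \<Rightarrow> real) \<Rightarrow> nat set \<Rightarrow> real set" where
  "ball_union x r I = (\<Union>i\<in>I. cball (x i) (r i)) \<inter> {0..1}"

(* The indices j 1, ..., j k need not be distinct.  For n > 0 the minimum is attained, because
   k = n with j the identity is admissible. *)
definition cover_number :: "(nat \<Rightarrow> real) \<Rightarrow> (nat \<Rightarrow> real) \<Rightarrow> nat \<Rightarrow> nat" where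
  "cover_number x r n =
     (if n = 0 then 0
      else (LEAST k. k \<ge> 1 \<and> (\<exists>j :: nat \<Rightarrow> nat. j ` {1..k} \<subseteq> {1..n} \<and>
              ball_union x r {1..n} = ball_union x r (j ` {1..k}))))"

end

theory Submission
  imports Defs
begin

text \<open>
  The upper bound rests on irredundant subfamilies.  In a subfamily of least size with the same union, no
  interval is covered by the others, and then no point lies in three of them: among three intervals
  through a common point, the one reaching furthest left and the one reaching furthest right cover the
  third.  So the traces on the unit interval have total length at most 2, and as a trace has length at
  least \<open>min r 1\<close> when the centre lies in the unit interval, a cover number of at least \<open>n\<close> yields
  \<open>n\<close> indices with \<open>\<Sum> min (R i) 1 \<le> 2\<close> (\<open>cover_number_ge_imp_short_subfamily\<close>).

  Upper bound (\<open>prob_cover_count_ge_upper\<close>, \<open>laplace_transform_radius_le\<close>).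
  The expected number of \<open>n\<close>-element subsets of \<open>{1..N}\<close> is \<open>rate ^ n / n!\<close>, which
  accounts for \<open>exp (- n ln n)\<close>.  By the exponential Markov inequality with parameter \<open>s = n\<close>, a fixed subset
  satisfies the length constraint with probability at most \<open>exp (2 n)\<close> times the \<open>n\<close>-th power of
  \<open>E exp (- n min R 1)\<close>.  A density of order \<open>z powr (\<alpha> - 1)\<close> at 0 makes this Laplace transform
  \<open>O(n powr - \<alpha>)\<close>, which accounts for the remaining \<open>exp (- \<alpha> n ln n)\<close>; all other factors are
  \<open>exp (O(n))\<close>.

  Lower bound (\<open>prob_cover_count_ge_lower\<close>, \<open>prob_radius_dyadic_ge\<close>).  It suffices
  that \<open>N = n\<close>, that the centres lie in \<open>n\<close> distinct well separated cells of length \<open>1 / (2 n)\<close>,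
  and that all radii lie in \<open>{h / 2..h}\<close> with \<open>h = 1 / (4 n)\<close>: each centre is then
  covered by its own interval only.  The \<open>n!\<close> ways to assign the cells cancel the factorial of the Poisson
  weight, each centre costs \<open>1 / (2 n)\<close>, and each radius costs a constant times \<open>n powr - \<alpha>\<close>.
\<close>

section \<open>Irredundant families of intervals\<close>

lemma irredundant_intervals_multiplicity:
  fixes a b :: "'i \<Rightarrow> real"
  assumes "finite I"
    and irredundant: "\<And>i. i \<in> I \<Longrightarrow> \<not> {a i..b i} \<subseteq> (\<Union>j\<in>I - {i}. {a j..b j})"
  shows "card {i\<in>I. t \<in> {a i..b i}} \<le> 2"
proof (rule ccontr)
  define T where "T = {i\<in>I. t \<in> {a i..b i}}"
  assume "\<not> card {i\<in>I. t \<in> {a i..b i}} \<le> 2"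
  then have card: "card T > 2" by (simp add: T_def)
  have fin: "finite T" using assms(1) by (simp add: T_def)
  have "T \<noteq> {}" using card by auto
  obtain l where l: "l \<in> T" "\<And>i. i \<in> T \<Longrightarrow> a l \<le> a i"
    using arg_min_if_finite(1)[OF fin \<open>T \<noteq> {}\<close>, of a] arg_min_least[OF fin \<open>T \<noteq> {}\<close>, of _ a] by blast
  have "Max (b ` T) \<in> b ` T" using fin \<open>T \<noteq> {}\<close> by (intro Max_in) auto
  then obtain u where u: "u \<in> T" "b u = Max (b ` T)" by auto
  have u': "b i \<le> b u" if "i \<in> T" for i using that fin u by simp
  have "card {l, u} \<le> 2" by (simp add: card_insert_if)
  then have "\<not> T \<subseteq> {l, u}" using card card_mono[of "{l,u}" T] by auto
  then obtain i where i: "i \<in> T" "i \<noteq> l" "i \<noteq> u" by auto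
  \<comment> \<open>All members of \<open>T\<close> contain \<open>t\<close>, so the ones reaching furthest left and right cover the others.\<close>
  have "{a i..b i} \<subseteq> {a l..b l} \<union> {a u..b u}"
    using l(1) l(2)[OF i(1)] u(1) u'[OF i(1)] by (force simp: T_def)
  also have "\<dots> \<subseteq> (\<Union>j\<in>I - {i}. {a j..b j})"
    using i l(1) u(1) by (auto simp: T_def)
  finally show False using irredundant[of i] i(1) by (auto simp: T_def)
qed

text \<open>
  Integrating the multiplicity bound: the total length is the integral of the number of intervals
  through \<open>t\<close>, which is at most 2 on \<open>{c..d}\<close> and 0 elsewhere.
\<close>

lemma irredundant_intervals_total_length:
  fixes a b :: "'i \<Rightarrow> real"
  assumes "finite I"
    and irredundant: "\<And>i. i \<in> I \<Longrightarrow> \<not> {a i..b i} \<subseteq> (\<Union>j\<in>I - {i}. {a j..b j})"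
    and bounds: "\<And>i. i \<in> I \<Longrightarrow> c \<le> a i \<and> a i \<le> b i \<and> b i \<le> d" and "c \<le> d"
  shows "(\<Sum>i\<in>I. b i - a i) \<le> 2 * (d - c)"
proof -
  have "(\<Sum>i\<in>I. ennreal (b i - a i)) = (\<Sum>i\<in>I. emeasure lborel {a i..b i})"
    using bounds by (intro sum.cong) auto
  also have "\<dots> = (\<Sum>i\<in>I. \<integral>\<^sup>+t. indicator {a i..b i} t \<partial>lborel)"
    by (simp add: nn_integral_indicator)
  also have "\<dots> = (\<integral>\<^sup>+t. (\<Sum>i\<in>I. indicator {a i..b i} t) \<partial>lborel)"
    by (subst nn_integral_sum) auto
  also have "\<dots> \<le> (\<integral>\<^sup>+t. 2 * indicator {c..d} t \<partial>lborel)"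
  proof (rule nn_integral_mono)
    fix t :: real
    have "(\<Sum>i\<in>I. indicator {a i..b i} t) = (of_nat (card {i\<in>I. t \<in> {a i..b i}}) :: ennreal)"
      using assms(1) by (simp add: indicator_def sum.If_cases Int_def del: atLeastAtMost_iff)
    also have "\<dots> \<le> 2 * indicator {c..d} t"
    proof (cases "t \<in> {c..d}")
      case True
      have "card {i\<in>I. t \<in> {a i..b i}} \<le> 2"
        by (rule irredundant_intervals_multiplicity[OF assms(1) irredundant])
      then have "(of_nat (card {i\<in>I. t \<in> {a i..b i}}) :: ennreal) \<le> of_nat 2"
        by (intro of_nat_mono)
      then show ?thesis using True by simp
    next
      case False
      then have empty: "{i\<in>I. t \<in> {a i..b i}} = {}" using bounds by fastforce
      show ?thesis by (subst empty) simp
    qed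
    finally show "(\<Sum>i\<in>I. indicator {a i..b i} t) \<le> (2 * indicator {c..d} t :: ennreal)" .
  qed
  also have "\<dots> = 2 * ennreal (d - c)"
    using \<open>c \<le> d\<close> by (simp add: nn_integral_cmult)
  also have "\<dots> = ennreal (2 * (d - c))" by (simp add: ennreal_mult' del: right_diff_distrib_numeral)
  finally have "ennreal (\<Sum>i\<in>I. b i - a i) \<le> ennreal (2 * (d - c))"
    using bounds by (subst (asm) sum_ennreal) auto
  then show ?thesis using \<open>c \<le> d\<close> by (subst (asm) ennreal_le_iff) auto
qed

section \<open>The cover number\<close>

lemma cball_Int_unit_interval:
  fixes x r :: real
  shows "cball x r \<inter> {0..1} = {max 0 (x - r)..min 1 (x + r)}"
  by (auto simp: cball_eq_atLeastAtMost)

lemma centre_in_ball_union: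
  "i \<in> A \<Longrightarrow> x i \<in> {0..1} \<Longrightarrow> r i \<ge> 0 \<Longrightarrow> x i \<in> ball_union x r A"
  by (auto simp: ball_union_def intro!: bexI[of _ i])

lemma ex_enumeration:
  assumes "A \<subseteq> {1..m}"
  obtains j :: "nat \<Rightarrow> nat" where "j ` {1..card A} = A"
  using ex_bij_betw_nat_finite_1[of A] finite_subset[OF assms] by (auto simp: bij_betw_def)

lemma cover_number_le_card:
  assumes "A \<subseteq> {1..m}" "A \<noteq> {}" "ball_union x r A = ball_union x r {1..m}"
  shows "cover_number x r m \<le> card A"
proof -
  obtain j where "j ` {1..card A} = A" using ex_enumeration[OF assms(1)] .
  moreover have "card A \<ge> 1"
    using assms(1,2) finite_subset[OF assms(1)] by (simp add: Suc_le_eq card_gt_0_iff)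
  ultimately have "card A \<ge> 1 \<and> (\<exists>j :: nat \<Rightarrow> nat. j ` {1..card A} \<subseteq> {1..m} \<and>
              ball_union x r {1..m} = ball_union x r (j ` {1..card A}))"
    using assms by metis
  then show ?thesis unfolding cover_number_def by (auto intro: Least_le)
qed

text \<open>
  The witness is any \<open>n\<close>-element part of a subfamily of least size with the full union.  Minimality makes
  that subfamily irredundant, and it has at least as many members as the cover number requires.  The
  truncation at 1 accounts for balls that stick out of the unit interval.
\<close>

lemma cover_number_ge_imp_short_subfamily:
  assumes centres: "\<And>i. i \<in> {1..m} \<Longrightarrow> x i \<in> {0..1}" and radii: "\<And>i. i \<in> {1..m} \<Longrightarrow> r i > 0"
    and n: "cover_number x r m \<ge> n" "n \<ge> 1"
  shows "\<exists>I. I \<subseteq> {1..m} \<and> card I = n \<and> (\<Sum>i\<in>I. min (r i) 1) \<le> 2"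
proof -
  define covers where "covers A \<longleftrightarrow> A \<subseteq> {1..m} \<and> ball_union x r A = ball_union x r {1..m}" for A
  obtain A where A: "covers A" "\<And>B. covers B \<Longrightarrow> card A \<le> card B"
    using ex_has_least_nat[of covers "{1..m}" card] by (auto simp: covers_def)
  have sub: "A \<subseteq> {1..m}" and fin: "finite A"
    using A(1) finite_subset by (auto simp: covers_def)
  have "m \<ge> 1" using n by (cases m) (auto simp: cover_number_def)
  then have "x 1 \<in> ball_union x r {1..m}"
    using centres[of 1] radii[of 1] by (intro centre_in_ball_union) auto
  then have "x 1 \<in> ball_union x r A" using A(1) by (simp add: covers_def)
  then have "A \<noteq> {}" by (auto simp: ball_union_def)
  then have "cover_number x r m \<le> card A"
    using A(1) by (intro cover_number_le_card[OF sub]) (simp_all add: covers_def)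
  then have "n \<le> card A" using n by simp
  define a b where "a i = max 0 (x i - r i)" and "b i = min 1 (x i + r i)" for i
  have ab: "cball (x i) (r i) \<inter> {0..1} = {a i..b i}" for i
    by (simp add: a_def b_def cball_Int_unit_interval)
  have union: "ball_union x r B = (\<Union>i\<in>B. {a i..b i})" for B
    by (auto simp: ball_union_def simp flip: ab)
  have irredundant: "\<not> {a i..b i} \<subseteq> (\<Union>j\<in>A - {i}. {a j..b j})" if i: "i \<in> A" for i
  proof
    assume "{a i..b i} \<subseteq> (\<Union>j\<in>A - {i}. {a j..b j})"
    then have "ball_union x r (A - {i}) = ball_union x r A" using i by (auto simp: union)
    then have "covers (A - {i})" using A(1) by (auto simp: covers_def)
    then show False using A(2)[of "A - {i}"] i fin by (auto dest: card_Diff1_less)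
  qed
  have "(\<Sum>i\<in>A. b i - a i) \<le> 2 * (1 - 0)"
  proof (rule irredundant_intervals_total_length[OF fin irredundant])
    fix i assume "i \<in> A"
    then have "x i \<in> {0..1}" "r i > 0" using centres radii sub by blast+
    then show "0 \<le> a i \<and> a i \<le> b i \<and> b i \<le> 1" by (auto simp: a_def b_def)
  qed auto
  moreover have "min (r i) 1 \<le> b i - a i" if "i \<in> A" for i
  proof -
    have "x i \<in> {0..1}" "r i > 0" using centres radii sub that by blast+
    then show ?thesis by (auto simp: a_def b_def min_def max_def)
  qed
  ultimately have sum: "(\<Sum>i\<in>A. min (r i) 1) \<le> 2"
    using sum_mono[of A "\<lambda>i. min (r i) 1" "\<lambda>i. b i - a i"] by simp
  obtain I where I: "I \<subseteq> A" "card I = n" using obtain_subset_with_card_n[OF \<open>n \<le> card A\<close>] by metis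
  have "(\<Sum>i\<in>I. min (r i) 1) \<le> (\<Sum>i\<in>A. min (r i) 1)"
  proof (rule sum_mono2[OF fin I(1)])
    show "0 \<le> min (r i) 1" if "i \<in> A - I" for i
      using radii[of i] that sub by (auto simp: less_imp_le)
  qed
  then show ?thesis using I sub sum by (intro exI[of _ I]) auto
qed

text \<open>
  No member of the family can be dropped, because its centre lies in no other ball.
\<close>

lemma cover_number_ge_if_centres_isolated:
  assumes centres: "\<And>i. i \<in> {1..m} \<Longrightarrow> x i \<in> {0..1}" and radii: "\<And>i. i \<in> {1..m} \<Longrightarrow> r i \<ge> 0"
    and isolated: "\<And>i j. i \<in> {1..m} \<Longrightarrow> j \<in> {1..m} \<Longrightarrow> i \<noteq> j \<Longrightarrow> \<bar>x i - x j\<bar> > r j"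
  shows "cover_number x r m \<ge> m"
proof (cases "m = 0")
  case False
  define P where "P k \<longleftrightarrow> k \<ge> 1 \<and> (\<exists>j :: nat \<Rightarrow> nat. j ` {1..k} \<subseteq> {1..m} \<and>
              ball_union x r {1..m} = ball_union x r (j ` {1..k}))" for k
  have "P m" unfolding P_def using False by (auto intro!: exI[of _ id])
  then have "P (cover_number x r m)"
    using False LeastI[of P m] by (simp add: cover_number_def P_def[abs_def])
  then obtain j :: "nat \<Rightarrow> nat" where j: "j ` {1..cover_number x r m} \<subseteq> {1..m}"
    "ball_union x r {1..m} = ball_union x r (j ` {1..cover_number x r m})"
    unfolding P_def by auto
  have "{1..m} \<subseteq> j ` {1..cover_number x r m}"
  proof
    fix i assume i: "i \<in> {1..m}"
    then have "x i \<in> ball_union x r {1..m}"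
      using centres[OF i] radii[OF i] by (intro centre_in_ball_union)
    then obtain k where k: "k \<in> j ` {1..cover_number x r m}" "x i \<in> cball (x k) (r k)"
      unfolding j(2) by (auto simp: ball_union_def)
    then have "\<not> \<bar>x i - x k\<bar> > r k" by (auto simp: dist_real_def)
    moreover have "k \<in> {1..m}" using k(1) j(1) by blast
    ultimately have "i = k" using isolated[OF i, of k] by blast
    then show "i \<in> j ` {1..cover_number x r m}" using k(1) by simp
  qed
  then have "card {1..m} \<le> card {1..cover_number x r m}"
    by (intro surj_card_le) auto
  then show ?thesis by simp
qed simp

section \<open>Measurability of the cover number\<close>

text \<open>
  Reduces inclusion to countably many membership tests, so that it becomes an event for random
  endpoints.  Rational points alone do not detect a degenerate interval, hence the separate test of the
  left endpoint.
\<close>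

lemma interval_subset_closed_iff_rationals:
  fixes a b :: real
  assumes "closed U"
  shows "{a..b} \<subseteq> U \<longleftrightarrow> (a \<le> b \<longrightarrow> a \<in> U) \<and> (\<forall>q\<in>\<rat>. a \<le> q \<and> q \<le> b \<longrightarrow> q \<in> U)"
proof (intro iffI subsetI)
  fix t assume *: "(a \<le> b \<longrightarrow> a \<in> U) \<and> (\<forall>q\<in>\<rat>. a \<le> q \<and> q \<le> b \<longrightarrow> q \<in> U)" and t: "t \<in> {a..b}"
  show "t \<in> U"
  proof (cases "a < b")
    case True
    show ?thesis
    proof (rule ccontr)
      assume "t \<notin> U"
      then obtain e where e: "e > 0" "ball t e \<subseteq> - U"
        using assms openE[of "- U" t] by auto
      have "max a (t - e) < min b (t + e)" using True t e(1) by auto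
      then obtain q where q: "q \<in> \<rat>" "max a (t - e) < q" "q < min b (t + e)"
        using Rats_dense_in_real by blast
      then have "q \<in> ball t e" by (auto simp: dist_real_def)
      then show False using e(2) q * by auto
    qed
  next
    case False
    then have "t = a" "a \<le> b" using t by auto
    then show ?thesis using * by blast
  qed
qed auto

lemma ball_union_subset_iff:
  assumes "finite B"
  shows "ball_union x r A \<subseteq> ball_union x r B \<longleftrightarrow>
    (\<forall>i\<in>A. (max 0 (x i - r i) \<le> min 1 (x i + r i) \<longrightarrow> max 0 (x i - r i) \<in> ball_union x r B) \<and>
      (\<forall>q\<in>\<rat>. max 0 (x i - r i) \<le> q \<and> q \<le> min 1 (x i + r i) \<longrightarrow> q \<in> ball_union x r B))"
proof -
  have "closed (ball_union x r B)"
    unfolding ball_union_def using assms by (intro closed_Int closed_UN) auto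
  moreover have "ball_union x r A = (\<Union>i\<in>A. {max 0 (x i - r i)..min 1 (x i + r i)})"
    by (auto simp: ball_union_def simp flip: cball_Int_unit_interval)
  ultimately show ?thesis by (simp add: UN_subset_iff interval_subset_closed_iff_rationals)
qed

lemma pred_ball_union_subset:
  fixes X R :: "nat \<Rightarrow> 'a \<Rightarrow> real"
  assumes [measurable]: "\<And>i. i \<in> A \<union> B \<Longrightarrow> X i \<in> borel_measurable M"
      "\<And>i. i \<in> A \<union> B \<Longrightarrow> R i \<in> borel_measurable M" and "finite A" "finite B"
  shows "Measurable.pred M (\<lambda>\<omega>. ball_union (\<lambda>i. X i \<omega>) (\<lambda>i. R i \<omega>) A
            \<subseteq> ball_union (\<lambda>i. X i \<omega>) (\<lambda>i. R i \<omega>) B)"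
proof -
  have mem: "t \<in> ball_union x r B \<longleftrightarrow> (\<exists>i\<in>B. \<bar>x i - t\<bar> \<le> r i) \<and> 0 \<le> t \<and> t \<le> 1" for t x r
    by (auto simp: ball_union_def dist_real_def)
  have *[measurable]: "Measurable.pred M (\<lambda>\<omega>. f \<omega> \<in> ball_union (\<lambda>i. X i \<omega>) (\<lambda>i. R i \<omega>) B)"
    if [measurable]: "f \<in> borel_measurable M" for f :: "'a \<Rightarrow> real"
    unfolding mem using \<open>finite B\<close> by measurable
  show ?thesis
    unfolding ball_union_subset_iff[OF \<open>finite B\<close>]
    using \<open>finite A\<close> countable_rat by measurable
qed

text \<open>
  The definition quantifies over uncountably many enumerations \<open>j\<close>, but only the image of \<open>{1..k}\<close>
  matters, and there are finitely many such images.
\<close>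

lemma measurable_cover_number:
  fixes X R :: "nat \<Rightarrow> 'a \<Rightarrow> real"
  assumes X: "\<And>i. i \<in> {1..m} \<Longrightarrow> X i \<in> borel_measurable M"
      and R: "\<And>i. i \<in> {1..m} \<Longrightarrow> R i \<in> borel_measurable M"
  shows "(\<lambda>\<omega>. cover_number (\<lambda>i. X i \<omega>) (\<lambda>i. R i \<omega>) m) \<in> measurable M (count_space UNIV)"
proof -
  define \<J> where "\<J> k = {j ` {1..k} | j :: nat \<Rightarrow> nat. j ` {1..k} \<subseteq> {1..m}}" for k
  have fin: "finite (\<J> k)" for k
    by (rule finite_subset[of _ "Pow {1..m}"]) (auto simp: \<J>_def)
  have "Measurable.pred M (\<lambda>\<omega>. \<exists>J\<in>\<J> k.
      ball_union (\<lambda>i. X i \<omega>) (\<lambda>i. R i \<omega>) {1..m} = ball_union (\<lambda>i. X i \<omega>) (\<lambda>i. R i \<omega>) J)" for k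
  proof (rule pred_intros_finite(4)[OF fin])
    fix J assume "J \<in> \<J> k"
    then have J: "J \<subseteq> {1..m}" "finite J" by (auto simp: \<J>_def)
    then show "Measurable.pred M (\<lambda>\<omega>.
      ball_union (\<lambda>i. X i \<omega>) (\<lambda>i. R i \<omega>) {1..m} = ball_union (\<lambda>i. X i \<omega>) (\<lambda>i. R i \<omega>) J)"
      unfolding set_eq_subset
      by (intro pred_intros_logic(3) pred_ball_union_subset) (use X R in auto)
  qed
  note [measurable] = this
  have least: "cover_number x r m = (if m = 0 then 0
      else (LEAST k. k \<ge> 1 \<and> (\<exists>J\<in>\<J> k. ball_union x r {1..m} = ball_union x r J)))" for x r
    unfolding cover_number_def \<J>_def
    by (rule if_cong[OF refl refl], rule arg_cong[where f=Least], rule ext) blast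
  show ?thesis unfolding least by measurable
qed

section \<open>Elementary estimates\<close>

text \<open>
  The expected number of \<open>n\<close>-element subsets of a set of Poisson size, that is, the factorial moment
  divided by \<open>n!\<close>.
\<close>

lemma poisson_binomial_moment_sums:
  fixes rate :: real
  assumes "rate > 0"
  shows "(\<lambda>m. pmf (poisson_pmf rate) m * real (m choose n)) sums (rate ^ n / fact n)"
proof -
  have "(\<lambda>k. rate ^ n / fact n * exp (- rate) * (rate ^ k /\<^sub>R fact k)) sums
          (rate ^ n / fact n * exp (- rate) * exp rate)"
    by (intro sums_mult exp_converges)
  also have "(\<lambda>k. rate ^ n / fact n * exp (- rate) * (rate ^ k /\<^sub>R fact k)) =
      (\<lambda>k. pmf (poisson_pmf rate) (k + n) * real ((k + n) choose n))"
    using assms by (simp add: fun_eq_iff binomial_fact power_add field_simps)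
  also have "rate ^ n / fact n * exp (- rate) * exp rate = rate ^ n / fact n"
    by (simp add: exp_minus field_simps)
  finally show ?thesis by (subst (asm) sums_zero_iff_shift) (auto simp: binomial_eq_0)
qed

lemma power_self_le_fact_mult_exp: "real n ^ n \<le> fact n * exp (real n)"
proof -
  have sums: "(\<lambda>k. real n ^ k /\<^sub>R fact k) sums exp (real n)" by (rule exp_converges)
  have "(\<Sum>k\<in>{n}. real n ^ k /\<^sub>R fact k) \<le> (\<Sum>k. real n ^ k /\<^sub>R fact k)"
    using sums by (intro sum_le_suminf) (auto simp: sums_iff)
  then show ?thesis using sums by (simp add: sums_iff field_simps)
qed

text \<open>
  The minimum treats both monotonicities of the power at once: for \<open>a \<ge> 0\<close> the smallest value is
  taken at \<open>h / 2\<close>, for \<open>a < 0\<close> at \<open>h\<close>.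
\<close>

lemma powr_ge_on_dyadic_interval:
  fixes a h z :: real
  assumes "0 < h" "h / 2 \<le> z" "z \<le> h"
  shows "min 1 (2 powr - a) * h powr a \<le> z powr a"
proof (cases "a \<ge> 0")
  case True
  have "min 1 (2 powr - a) * h powr a \<le> 2 powr - a * h powr a"
    by (intro mult_right_mono) auto
  also have "\<dots> = (h / 2) powr a" using assms by (simp add: powr_divide powr_minus_divide)
  also have "\<dots> \<le> z powr a" using assms True by (intro powr_mono2) auto
  finally show ?thesis .
next
  case False
  have "min 1 (2 powr - a) * h powr a \<le> 1 * h powr a" by (intro mult_right_mono) auto
  also have "\<dots> \<le> z powr a" using assms False by (auto intro: powr_mono2')
  finally show ?thesis .
qed

lemma Gamma_nn_integral_scaled:
  fixes a s :: real
  assumes "a > 0" "s > 0"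
  shows "(\<integral>\<^sup>+z. ennreal (indicator {0..} z * z powr (a - 1) / exp (s * z)) \<partial>lborel) =
    ennreal (Gamma a * s powr - a)"
proof -
  let ?I = "\<integral>\<^sup>+z. ennreal (indicator {0..} z * z powr (a - 1) / exp (s * z)) \<partial>lborel"
  have "ennreal (Gamma a) = (\<integral>\<^sup>+t. ennreal (indicator {0..} t * t powr (a - 1) / exp t) \<partial>lborel)"
    by (rule Gamma_conv_nn_integral_real[OF assms(1)])
  also have "\<dots> = ennreal s * (\<integral>\<^sup>+z. ennreal (indicator {0..} (s * z) * (s * z) powr (a - 1) / exp (s * z)) \<partial>lborel)"
    using assms by (subst nn_integral_real_affine[where c=s and t=0]) auto
  also have "(\<integral>\<^sup>+z. ennreal (indicator {0..} (s * z) * (s * z) powr (a - 1) / exp (s * z)) \<partial>lborel) =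
      (\<integral>\<^sup>+z. ennreal (s powr (a - 1)) * ennreal (indicator {0..} z * z powr (a - 1) / exp (s * z)) \<partial>lborel)"
    using assms by (intro nn_integral_cong)
      (auto simp: indicator_def ennreal_mult'[symmetric] powr_mult zero_le_mult_iff)
  also have "\<dots> = ennreal (s powr (a - 1)) * ?I" by (subst nn_integral_cmult) auto
  also have "ennreal s * (ennreal (s powr (a - 1)) * ?I) = ennreal (s powr a) * ?I"
    using assms by (simp add: mult.assoc[symmetric] ennreal_mult'[symmetric] powr_diff)
  finally have "ennreal (s powr - a) * ennreal (Gamma a) = (ennreal (s powr - a) * ennreal (s powr a)) * ?I"
    by (simp add: mult.assoc)
  also have "ennreal (s powr - a) * ennreal (s powr a) = 1"
    using assms by (simp add: ennreal_mult'[symmetric] powr_add[symmetric])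
  finally have "?I = ennreal (Gamma a) * ennreal (s powr - a)" by (simp add: mult.commute)
  also have "\<dots> = ennreal (Gamma a * s powr - a)" by (rule ennreal_mult''[symmetric]) simp
  finally show ?thesis .
qed

lemma exp_minus_le_powr:
  fixes a x :: real
  assumes "a > 0" "x > 0"
  shows "exp (- x) \<le> (a / x) powr a"
proof -
  have "ln (x / a) \<le> x / a - 1" using assms by (intro ln_le_minus_one) auto
  then have "a * ln (x / a) \<le> x" using assms by (simp add: field_simps)
  then have "- x \<le> a * ln (a / x)" using assms by (simp add: ln_div algebra_simps)
  then show ?thesis using assms by (simp add: powr_def)
qed

lemma approx_at_zero_powr_bounds:
  assumes "approx_at_zero p (\<lambda>z. z powr a)"
  obtains c C \<delta> where "c > 0" "C > 0" "\<delta> > 0"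
    "\<And>z. 0 < z \<Longrightarrow> z < \<delta> \<Longrightarrow> c * z powr a \<le> p z"
    "\<And>z. 0 < z \<Longrightarrow> z < \<delta> \<Longrightarrow> p z \<le> C * z powr a"
proof -
  obtain c C where c: "c > 0" and ev: "\<forall>\<^sub>F z in at_right 0. c \<le> p z / z powr a \<and> p z / z powr a \<le> C"
    using assms unfolding approx_at_zero_def by blast
  obtain \<delta> where \<delta>: "\<delta> > 0" "\<And>z. 0 < z \<Longrightarrow> z < \<delta> \<Longrightarrow> c \<le> p z / z powr a \<and> p z / z powr a \<le> C"
    using ev unfolding eventually_at_right_field by blast
  have "c \<le> C" using \<delta>(2)[of "\<delta> / 2"] \<delta>(1) by auto
  show ?thesis
    by (rule that[of c C \<delta>]) (use c \<open>c \<le> C\<close> \<delta> in \<open>auto simp: field_simps\<close>)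
qed

text \<open>
  A factor \<open>exp (O(n))\<close> is negligible against \<open>n ln n\<close>: the relative error is \<open>O(1 / ln n)\<close>.
\<close>

lemma log_asymptotics_of_exp_bounds:
  fixes f :: "nat \<Rightarrow> real"
  assumes "\<beta> > 0"
    and lower: "\<forall>\<^sub>F n in sequentially. exp (- (\<beta> * real n * ln (real n)) - A * real n) \<le> f n"
    and upper: "\<forall>\<^sub>F n in sequentially. f n \<le> exp (- (\<beta> * real n * ln (real n)) + A * real n)"
  shows "\<exists>\<epsilon> :: nat \<Rightarrow> real. \<epsilon> \<longlonglongrightarrow> 0 \<and>
    (\<forall>\<^sub>F n in sequentially. f n = exp (- (\<beta> * real n * ln (real n) * (1 + \<epsilon> n))))"
proof (intro exI conjI)
  define \<epsilon> where "\<epsilon> n = - ln (f n) / (\<beta> * real n * ln (real n)) - 1" for n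
  have ev: "\<forall>\<^sub>F n in sequentially. n \<ge> (2::nat)" by (rule eventually_ge_at_top)
  have pos: "\<beta> * real n * ln (real n) > 0" if "n \<ge> 2" for n
    using that assms(1) by (intro mult_pos_pos) auto
  show "\<forall>\<^sub>F n in sequentially. f n = exp (- (\<beta> * real n * ln (real n) * (1 + \<epsilon> n)))"
    using lower ev
  proof eventually_elim
    case (elim n)
    have "f n > 0" by (rule less_le_trans[OF exp_gt_zero elim(1)])
    moreover have "L * (1 + (- ln (f n) / L - 1)) = - ln (f n)" if "L > 0" for L
      using that by simp
    from this[OF pos[OF elim(2)]] have "\<beta> * real n * ln (real n) * (1 + \<epsilon> n) = - ln (f n)"
      by (simp only: \<epsilon>_def)
    ultimately show ?case by simp
  qed
  show "\<epsilon> \<longlonglongrightarrow> 0"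
  proof (rule Lim_null_comparison)
    show "\<forall>\<^sub>F n in sequentially. norm (\<epsilon> n) \<le> A / \<beta> / ln (real n)"
      using lower upper ev
    proof eventually_elim
      case (elim n)
      define L where "L = \<beta> * real n * ln (real n)"
      have "L > 0" unfolding L_def by (rule pos[OF elim(3)])
      have "f n > 0" by (rule less_le_trans[OF exp_gt_zero elim(1)])
      then have "exp (- L - A * real n) \<le> exp (ln (f n))" "exp (ln (f n)) \<le> exp (- L + A * real n)"
        using elim(1,2) by (simp_all add: L_def)
      then have "\<bar>ln (f n) + L\<bar> \<le> A * real n"
        unfolding exp_le_cancel_iff by linarith
      moreover have "\<epsilon> n = - (ln (f n) + L) / L"
        using \<open>L > 0\<close> unfolding \<epsilon>_def L_def[symmetric] by (simp add: field_simps)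
      ultimately have "norm (\<epsilon> n) \<le> A * real n / L"
        using \<open>L > 0\<close> by (simp add: abs_divide divide_right_mono)
      also have "A * x / (\<beta> * x * y) = A / \<beta> / y" if "x > 0" for x y :: real
        using that by simp
      from this[of "real n" "ln (real n)"] have "A * real n / L = A / \<beta> / ln (real n)"
        using elim(3) by (simp add: L_def)
      finally show ?case .
    qed
    show "(\<lambda>n. A / \<beta> / ln (real n)) \<longlonglongrightarrow> 0"
      by (intro tendsto_divide_0[OF tendsto_const] filterlim_at_top_imp_at_infinity
          filterlim_compose[OF ln_at_top filterlim_real_sequentially])
  qed
qed

lemma powr_power_eq_exp:
  fixes b :: real
  assumes "b > 0" "n \<ge> 1"
  shows "(b * real n powr a) ^ n = exp (real n * ln b + a * real n * ln (real n))"
proof -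
  have "b * real n powr a = exp (ln b + a * ln (real n))"
    using assms by (simp add: exp_add powr_def)
  then have "(b * real n powr a) ^ n = exp (real n * (ln b + a * ln (real n)))"
    by (simp only: exp_of_nat_mult)
  then show ?thesis by (simp add: algebra_simps)
qed

lemma powr_minus_one_plus:
  fixes x a :: real
  assumes "x > 0"
  shows "x powr - (1 + a) = x powr - a * (1 / x)"
proof -
  have "x powr - (1 + a) = x powr (- a + - 1)" by (simp add: algebra_simps)
  also have "\<dots> = x powr - a * x powr - 1" by (rule powr_add)
  finally show ?thesis using assms by (simp add: powr_minus_divide)
qed

section \<open>The Poisson model\<close>

text \<open>
  The centres, the radii and the number of intervals form a single independent family, indexed by a sum
  type so that joint events about all three factorise at once.
\<close>

locale poisson_intervals = prob_space M for M :: "'a measure" +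
  fixes \<xi> R :: "nat \<Rightarrow> 'a \<Rightarrow> real"
    and N :: "'a \<Rightarrow> nat"
    and p :: "real \<Rightarrow> real"
    and rate :: real
  assumes rate_pos: "rate > 0"
    and independent: "indep_vars (\<lambda>_. borel)
           (case_sum \<xi> (case_sum R (\<lambda>_::unit. \<lambda>\<omega>. real (N \<omega>))))
           ({1..} <+> {1..} <+> {()})"
    and centres: "\<And>i. i \<ge> 1 \<Longrightarrow> distr M borel (\<xi> i) = uniform_measure lborel {0..1}"
    and radii: "\<And>i. i \<ge> 1 \<Longrightarrow> distributed M lborel (R i) (\<lambda>z. ennreal (p z))"
    and measurable_number [measurable]: "N \<in> measurable M (count_space UNIV)"
    and number: "distr M (count_space UNIV) N = measure_pmf (poisson_pmf rate)"
    and density_support: "\<And>z. z \<le> 0 \<Longrightarrow> p z = 0"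
begin

abbreviation cover_count :: "'a \<Rightarrow> nat" where
  "cover_count \<omega> \<equiv> cover_number (\<lambda>i. \<xi> i \<omega>) (\<lambda>i. R i \<omega>) (N \<omega>)"

lemma measurable_centre: "i \<ge> 1 \<Longrightarrow> \<xi> i \<in> borel_measurable M"
  using bspec[OF conjunct1[OF independent[unfolded indep_vars_def2]], of "Inl i"] by auto

lemma measurable_radius: "i \<ge> 1 \<Longrightarrow> R i \<in> borel_measurable M"
  using distributed_measurable[OF radii] by simp

lemma measurable_cover_count [measurable]: "cover_count \<in> measurable M (count_space UNIV)"
  by (rule measurable_compose_countable[OF measurable_cover_number measurable_number])
     (auto intro: measurable_centre measurable_radius)

lemma cover_count_event: "{\<omega>\<in>space M. cover_count \<omega> \<ge> n} \<in> events"
  using measurable_sets[OF measurable_cover_count, of "{n..}"]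
  by (simp add: vimage_def Int_def conj_commute)

lemma AE_centre: "i \<ge> 1 \<Longrightarrow> AE \<omega> in M. \<xi> i \<omega> \<in> {0..1}"
proof -
  assume i: "i \<ge> 1"
  have "AE x in uniform_measure lborel {0..1::real}. x \<in> {0..1}"
    by (rule AE_uniform_measureI) auto
  then have "AE x in distr M borel (\<xi> i). x \<in> {0..1}" by (simp only: centres[OF i])
  then show ?thesis by (rule AE_distrD[OF measurable_centre[OF i]])
qed

lemma AE_radius: "i \<ge> 1 \<Longrightarrow> AE \<omega> in M. R i \<omega> > 0"
  by (subst distributed_AE2[OF radii]) (auto simp: not_le[symmetric] density_support)

lemma prob_number: "prob {\<omega>\<in>space M. N \<omega> = m} = pmf (poisson_pmf rate) m"
proof -
  have "pmf (poisson_pmf rate) m = measure (distr M (count_space UNIV) N) {m}"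
    by (simp add: number measure_pmf_single)
  also have "\<dots> = prob (N -` {m} \<inter> space M)" by (subst measure_distr) auto
  also have "N -` {m} \<inter> space M = {\<omega>\<in>space M. N \<omega> = m}" by auto
  finally show ?thesis by simp
qed

lemma prob_centre:
  assumes "i \<ge> 1" "{a..b} \<subseteq> {0..1}" "a \<le> b"
  shows "prob {\<omega>\<in>space M. \<xi> i \<omega> \<in> {a..b}} = b - a"
proof -
  have "{\<omega>\<in>space M. \<xi> i \<omega> \<in> {a..b}} = \<xi> i -` {a..b} \<inter> space M" by auto
  also have "prob \<dots> = measure (distr M borel (\<xi> i)) {a..b}"
    using measurable_centre[OF assms(1)] by (subst measure_distr) auto
  also have "\<dots> = measure lborel ({0..1} \<inter> {a..b})"
    by (simp add: centres[OF assms(1)] measure_def emeasure_uniform_measure divide_ennreal_def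
        del: Int_atLeastAtMost)
  also have "{0..1} \<inter> {a..b} = {a..b}" using assms by auto
  finally show ?thesis using assms by simp
qed

section \<open>Upper bound by the exponential Markov inequality\<close>

lemma expectation_prod_radii:
  fixes g :: "real \<Rightarrow> ennreal"
  assumes I: "finite I" "I \<subseteq> {1..}" and [measurable]: "g \<in> borel_measurable borel"
  shows "(\<integral>\<^sup>+\<omega>. (\<Prod>i\<in>I. g (R i \<omega>)) * indicator {\<omega>. N \<omega> = m} \<omega> \<partial>M) =
    (\<Prod>i\<in>I. \<integral>\<^sup>+\<omega>. g (R i \<omega>) \<partial>M) * ennreal (pmf (poisson_pmf rate) m)"
proof -
  let ?Z = "case_sum \<xi> (case_sum R (\<lambda>_::unit. \<lambda>\<omega>. real (N \<omega>)))"
  (* The empty first summand discards the centres. *)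
  let ?T = "{} <+> I <+> {()}"
  define G :: "nat + nat + unit \<Rightarrow> real \<Rightarrow> ennreal" where
    "G = case_sum (\<lambda>_ _. 1) (case_sum (\<lambda>_. g) (\<lambda>_. indicator {real m}))"
  have "indep_vars (\<lambda>_. borel) ?Z ?T"
    by (rule indep_vars_subset[OF independent]) (use I in auto)
  then have "indep_vars (\<lambda>_. borel) (\<lambda>t \<omega>. G t (?Z t \<omega>)) ?T"
    by (rule indep_vars_compose2) (auto simp: G_def)
  then have "(\<integral>\<^sup>+\<omega>. (\<Prod>t\<in>?T. G t (?Z t \<omega>)) \<partial>M) = (\<Prod>t\<in>?T. \<integral>\<^sup>+\<omega>. G t (?Z t \<omega>) \<partial>M)"
    by (intro indep_vars_nn_integral) (use I in auto)
  also have "\<dots> = (\<Prod>i\<in>I. \<integral>\<^sup>+\<omega>. g (R i \<omega>) \<partial>M) * (\<integral>\<^sup>+\<omega>. indicator {real m} (real (N \<omega>)) \<partial>M)"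
    using I by (simp add: prod.Plus G_def)
  also have "(\<integral>\<^sup>+\<omega>. indicator {real m} (real (N \<omega>)) \<partial>M) =
      (\<integral>\<^sup>+\<omega>. indicator {\<omega>\<in>space M. N \<omega> = m} \<omega> \<partial>M)"
    by (intro nn_integral_cong) (auto simp: indicator_def)
  also have "\<dots> = ennreal (pmf (poisson_pmf rate) m)"
    by (subst nn_integral_indicator) (auto simp: emeasure_eq_measure prob_number)
  also have "(\<integral>\<^sup>+\<omega>. (\<Prod>t\<in>?T. G t (?Z t \<omega>)) \<partial>M) =
      (\<integral>\<^sup>+\<omega>. (\<Prod>i\<in>I. g (R i \<omega>)) * indicator {\<omega>. N \<omega> = m} \<omega> \<partial>M)"
    using I by (intro nn_integral_cong) (simp add: prod.Plus G_def indicator_def)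
  finally show ?thesis .
qed

text \<open>
  Exponential Markov inequality: on the event, \<open>exp (2 * s)\<close> times the product of the variables
  \<open>exp (- s * min (R i) 1)\<close> is at least 1.
\<close>

lemma prob_short_subfamily_le:
  assumes "s \<ge> 0" "\<phi> \<ge> 0" and I: "finite I" "I \<subseteq> {1..}"
    and laplace: "\<And>i. i \<ge> 1 \<Longrightarrow> (\<integral>\<^sup>+\<omega>. ennreal (exp (- s * min (R i \<omega>) 1)) \<partial>M) \<le> ennreal \<phi>"
  shows "prob {\<omega>\<in>space M. N \<omega> = m \<and> (\<Sum>i\<in>I. min (R i \<omega>) 1) \<le> 2}
    \<le> exp (2 * s) * \<phi> ^ card I * pmf (poisson_pmf rate) m"
proof -
  have [measurable]: "R i \<in> borel_measurable M" if "i \<in> I" for i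
    using measurable_radius I that by auto
  let ?E = "{\<omega>\<in>space M. N \<omega> = m \<and> (\<Sum>i\<in>I. min (R i \<omega>) 1) \<le> 2}"
  have "emeasure M ?E = (\<integral>\<^sup>+\<omega>. indicator ?E \<omega> \<partial>M)" by simp
  also have "\<dots> \<le> (\<integral>\<^sup>+\<omega>. ennreal (exp (2 * s)) *
      ((\<Prod>i\<in>I. ennreal (exp (- s * min (R i \<omega>) 1))) * indicator {\<omega>. N \<omega> = m} \<omega>) \<partial>M)"
  proof (rule nn_integral_mono)
    fix \<omega> show "indicator ?E \<omega> \<le> ennreal (exp (2 * s)) *
      ((\<Prod>i\<in>I. ennreal (exp (- s * min (R i \<omega>) 1))) * indicator {\<omega>. N \<omega> = m} \<omega>)"
    proof (cases "\<omega> \<in> ?E")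
      case True
      have "(\<Prod>i\<in>I. ennreal (exp (- s * min (R i \<omega>) 1))) = ennreal (exp (- s * (\<Sum>i\<in>I. min (R i \<omega>) 1)))"
        using I by (simp add: prod_ennreal exp_sum[symmetric] sum_negf sum_distrib_left)
      moreover have "1 \<le> exp (2 * s) * exp (- s * (\<Sum>i\<in>I. min (R i \<omega>) 1))"
        using True \<open>s \<ge> 0\<close> mult_left_mono[of "\<Sum>i\<in>I. min (R i \<omega>) 1" 2 s]
        by (auto simp: exp_add[symmetric])
      ultimately show ?thesis using True by (simp add: ennreal_mult[symmetric])
    qed auto
  qed
  also have "\<dots> = ennreal (exp (2 * s)) * ((\<Prod>i\<in>I. \<integral>\<^sup>+\<omega>. ennreal (exp (- s * min (R i \<omega>) 1)) \<partial>M)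
      * ennreal (pmf (poisson_pmf rate) m))"
    by (subst nn_integral_cmult, measurable)
       (subst expectation_prod_radii[OF I, of "\<lambda>z. ennreal (exp (- s * min z 1))"], auto)
  also have "\<dots> \<le> ennreal (exp (2 * s)) * ((\<Prod>i\<in>I. ennreal \<phi>) * ennreal (pmf (poisson_pmf rate) m))"
  proof (intro mult_left_mono mult_right_mono prod_mono_ennreal)
    fix i assume "i \<in> I"
    then show "(\<integral>\<^sup>+\<omega>. ennreal (exp (- s * min (R i \<omega>) 1)) \<partial>M) \<le> ennreal \<phi>"
      using I by (intro laplace) auto
  qed auto
  also have "\<dots> = ennreal (exp (2 * s) * \<phi> ^ card I * pmf (poisson_pmf rate) m)"
    using \<open>\<phi> \<ge> 0\<close> by (simp only: prod_constant ennreal_power[OF \<open>\<phi> \<ge> 0\<close>])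
      (simp add: ennreal_mult'[symmetric] mult.assoc del: pmf_poisson)
  finally show ?thesis
    using \<open>\<phi> \<ge> 0\<close> by (subst (asm) emeasure_eq_measure, subst (asm) ennreal_le_iff) auto
qed

text \<open>
  A union bound over the \<open>n\<close>-element subsets of \<open>{1..m}\<close>, separately on each event \<open>N = m\<close>; summing the
  number of subsets against the Poisson weights gives \<open>rate ^ n / n!\<close>.
\<close>

proposition prob_cover_count_ge_upper:
  assumes "n \<ge> 1" "s \<ge> 0" "\<phi> \<ge> 0"
    and laplace: "\<And>i. i \<ge> 1 \<Longrightarrow> (\<integral>\<^sup>+\<omega>. ennreal (exp (- s * min (R i \<omega>) 1)) \<partial>M) \<le> ennreal \<phi>"
  shows "prob {\<omega>\<in>space M. cover_count \<omega> \<ge> n} \<le> exp (2 * s) * \<phi> ^ n * (rate ^ n / fact n)"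
proof -
  define E where "E m = {\<omega>\<in>space M. cover_count \<omega> \<ge> n \<and> N \<omega> = m}" for m
  have [measurable]: "E m \<in> sets M" for m unfolding E_def by measurable
  have "(\<lambda>m. prob (E m)) sums prob (\<Union>m. E m)"
    by (intro finite_measure_UNION) (auto simp: disjoint_family_on_def E_def)
  also have "(\<Union>m. E m) = {\<omega>\<in>space M. cover_count \<omega> \<ge> n}" by (auto simp: E_def)
  finally have sums: "(\<lambda>m. prob (E m)) sums prob {\<omega>\<in>space M. cover_count \<omega> \<ge> n}" .
  have le: "prob (E m) \<le> exp (2 * s) * \<phi> ^ n * (pmf (poisson_pmf rate) m * real (m choose n))" for m
  proof -
    define \<I> where "\<I> = {I. I \<subseteq> {1..m} \<and> card I = n}"
    have \<I>: "finite I" "I \<subseteq> {1..}" "card I = n" if "I \<in> \<I>" for I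
      using that finite_subset by (auto simp: \<I>_def)
    have fin: "finite \<I>" by (simp add: \<I>_def)
    define F where "F I = {\<omega>\<in>space M. N \<omega> = m \<and> (\<Sum>i\<in>I. min (R i \<omega>) 1) \<le> 2}" for I
    have F[measurable]: "F I \<in> sets M" if "I \<in> \<I>" for I
    proof -
      have [measurable]: "R i \<in> borel_measurable M" if "i \<in> I" for i
        using measurable_radius \<I>(2)[OF \<open>I \<in> \<I>\<close>] that by auto
      show ?thesis unfolding F_def by measurable
    qed
    have "AE \<omega> in M. \<forall>i\<in>{1..m}. \<xi> i \<omega> \<in> {0..1} \<and> R i \<omega> > 0"
      by (intro AE_finite_allI AE_conjI AE_centre AE_radius) auto
    then have "AE \<omega> in M. \<omega> \<in> E m \<longrightarrow> \<omega> \<in> (\<Union>I\<in>\<I>. F I)"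
    proof (eventually_elim, intro impI)
      fix \<omega> assume *: "\<forall>i\<in>{1..m}. \<xi> i \<omega> \<in> {0..1} \<and> R i \<omega> > 0" and \<omega>: "\<omega> \<in> E m"
      have "cover_number (\<lambda>i. \<xi> i \<omega>) (\<lambda>i. R i \<omega>) m \<ge> n" using \<omega> by (auto simp: E_def)
      with * have "\<exists>I. I \<subseteq> {1..m} \<and> card I = n \<and> (\<Sum>i\<in>I. min (R i \<omega>) 1) \<le> 2"
        using \<open>n \<ge> 1\<close>
        by (intro cover_number_ge_imp_short_subfamily[where x="\<lambda>i. \<xi> i \<omega>" and r="\<lambda>i. R i \<omega>"]) auto
      then show "\<omega> \<in> (\<Union>I\<in>\<I>. F I)" using \<omega> by (auto simp: \<I>_def F_def E_def)
    qed
    then have "prob (E m) \<le> prob (\<Union>I\<in>\<I>. F I)"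
      using fin by (intro finite_measure_mono_AE) auto
    also have "\<dots> \<le> (\<Sum>I\<in>\<I>. prob (F I))"
      using fin by (intro finite_measure_subadditive_finite) auto
    also have "\<dots> \<le> (\<Sum>I\<in>\<I>. exp (2 * s) * \<phi> ^ n * pmf (poisson_pmf rate) m)"
    proof (rule sum_mono)
      fix I assume "I \<in> \<I>"
      from prob_short_subfamily_le[OF assms(2,3) \<I>(1,2)[OF this] laplace, of m]
      show "prob (F I) \<le> exp (2 * s) * \<phi> ^ n * pmf (poisson_pmf rate) m"
        unfolding F_def \<I>(3)[OF \<open>I \<in> \<I>\<close>] by simp
    qed
    also have "\<dots> = exp (2 * s) * \<phi> ^ n * (pmf (poisson_pmf rate) m * real (m choose n))"
      using n_subsets[of "{1..m}" n] by (simp add: \<I>_def mult_ac)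
    finally show ?thesis .
  qed
  show ?thesis
    by (rule sums_le[OF le sums sums_mult[OF poisson_binomial_moment_sums[OF rate_pos]]])
qed

section \<open>Lower bound by separated centres\<close>

text \<open>
  The unit interval is cut into \<open>n\<close> cells, and \<open>J k\<close> is the middle half of the \<open>k\<close>-th one.  For each
  permutation \<open>\<sigma>\<close> the event \<open>E \<sigma>\<close> puts the centre \<open>\<xi> i\<close> into \<open>J (\<sigma> i)\<close>; these events are disjoint, so their
  number \<open>n!\<close> enters as a factor and cancels the one in the Poisson weight.
\<close>

proposition prob_cover_count_ge_lower:
  assumes n: "n \<ge> 1" and h: "0 < h" "h < 1 / (2 * real n)" and "q \<ge> 0"
    and small: "\<And>i. i \<ge> 1 \<Longrightarrow> prob {\<omega>\<in>space M. R i \<omega> \<in> {h / 2..h}} \<ge> q"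
  shows "prob {\<omega>\<in>space M. cover_count \<omega> \<ge> n} \<ge> exp (- rate) * (rate * q / (2 * real n)) ^ n"
proof -
  let ?Z = "case_sum \<xi> (case_sum R (\<lambda>_::unit. \<lambda>\<omega>. real (N \<omega>)))"
  let ?T = "{1..n} <+> {1..n} <+> {()}"
  define J where "J k = {(4 * real k - 3) / (4 * real n)..(4 * real k - 1) / (4 * real n)}" for k
  have J_unit: "J k \<subseteq> {0..1}" if "k \<in> {1..n}" for k
  proof -
    have "0 \<le> (4 * real k - 3) / (4 * real n)" "(4 * real k - 1) / (4 * real n) \<le> 1"
      using that by (auto simp: divide_le_eq)
    then show ?thesis by (auto simp: J_def)
  qed
  have J_less: "1 / (2 * real n) \<le> y - x" if "x \<in> J k" "y \<in> J l" "k < l" for x y k l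
  proof -
    have "y - x \<ge> (4 * real l - 3) / (4 * real n) - (4 * real k - 1) / (4 * real n)"
      using that by (auto simp: J_def)
    also have "(4 * real l - 3) / (4 * real n) - (4 * real k - 1) / (4 * real n) =
        ((4 * real l - 3) - (4 * real k - 1)) / (4 * real n)"
      by (rule diff_divide_distrib[symmetric])
    also have "\<dots> \<ge> 2 / (4 * real n)"
      using \<open>k < l\<close> n by (intro divide_right_mono) auto
    finally show ?thesis by simp
  qed
  have J_apart: "1 / (2 * real n) \<le> \<bar>x - y\<bar>" if "x \<in> J k" "y \<in> J l" "k \<noteq> l" for x y k l
    using J_less[of x k y l] J_less[of y l x k] that by (cases k l rule: linorder_cases) auto
  define \<P> where "\<P> = {\<sigma>. \<sigma> permutes {1..n}}"
  have fin: "finite \<P>" and card: "card \<P> = fact n"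
    by (auto simp: \<P>_def finite_permutations card_permutations[OF refl])
  define B where "B \<sigma> = case_sum (\<lambda>i. J (\<sigma> i)) (case_sum (\<lambda>_::nat. {h / 2..h}) (\<lambda>_::unit. {real n}))"
    for \<sigma> :: "nat \<Rightarrow> nat"
  define E where "E \<sigma> = (\<Inter>t\<in>?T. ?Z t -` B \<sigma> t \<inter> space M)" for \<sigma>
  have E: "\<omega> \<in> E \<sigma> \<longleftrightarrow> \<omega> \<in> space M \<and> N \<omega> = n \<and> (\<forall>i\<in>{1..n}. \<xi> i \<omega> \<in> J (\<sigma> i) \<and> R i \<omega> \<in> {h / 2..h})"
    for \<omega> \<sigma> by (auto simp: E_def B_def Plus_def ball_Un)
  have Z: "?Z t \<in> borel_measurable M" if "t \<in> ?T" for t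
    using that by (auto intro!: measurable_centre measurable_radius)
  have B: "B \<sigma> t \<in> sets borel" for \<sigma> t
    by (auto simp: B_def J_def split: sum.split)
  have E_sets: "E \<sigma> \<in> sets M" for \<sigma>
    unfolding E_def by (intro sets.finite_INT measurable_sets[OF Z B]) auto
  have prob_E: "prob (E \<sigma>) \<ge> (1 / (2 * real n)) ^ n * (q ^ n * pmf (poisson_pmf rate) n)" if "\<sigma> \<in> \<P>" for \<sigma>
  proof -
    have "(1 / (2 * real n)) ^ n * (q ^ n * pmf (poisson_pmf rate) n) =
       (\<Prod>i=1..n. 1 / (2 * real n)) * ((\<Prod>i=1..n. q) * pmf (poisson_pmf rate) n)"
      by simp
    also have "\<dots> \<le> (\<Prod>i=1..n. prob (\<xi> i -` J (\<sigma> i) \<inter> space M)) *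
        ((\<Prod>i=1..n. prob (R i -` {h / 2..h} \<inter> space M)) * prob ((\<lambda>\<omega>. real (N \<omega>)) -` {real n} \<inter> space M))"
    proof (intro mult_mono prod_mono conjI)
      fix i assume i: "i \<in> {1..n}"
      have "\<sigma> i \<in> {1..n}" using \<open>\<sigma> \<in> \<P>\<close> i permutes_in_image by (fastforce simp: \<P>_def)
      then have "prob {\<omega>\<in>space M. \<xi> i \<omega> \<in> J (\<sigma> i)} = 1 / (2 * real n)"
        using i J_unit[of "\<sigma> i"] n unfolding J_def
        by (subst prob_centre) (auto simp: diff_divide_distrib[symmetric] divide_right_mono)
      then show "1 / (2 * real n) \<le> prob (\<xi> i -` J (\<sigma> i) \<inter> space M)"
        by (simp add: vimage_def Int_def conj_commute)
      show "q \<le> prob (R i -` {h / 2..h} \<inter> space M)"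
        using small[of i] i by (simp add: vimage_def Int_def conj_commute)
    next
      show "pmf (poisson_pmf rate) n \<le> prob ((\<lambda>\<omega>. real (N \<omega>)) -` {real n} \<inter> space M)"
        using prob_number[of n] by (simp add: vimage_def Int_def conj_commute)
    qed (use \<open>q \<ge> 0\<close> in \<open>auto intro!: prod_nonneg mult_nonneg_nonneg\<close>)
    also have "\<dots> = (\<Prod>t\<in>?T. prob (?Z t -` B \<sigma> t \<inter> space M))"
      by (simp add: prod.Plus B_def)
    also have "\<dots> = prob (E \<sigma>)"
      unfolding E_def by (rule indep_varsD[OF independent, symmetric]) (use B in auto)
    finally show ?thesis .
  qed
  have disjoint: "disjoint_family_on E \<P>"
  proof (unfold disjoint_family_on_def, intro ballI impI)
    fix \<sigma> \<tau> assume "\<sigma> \<in> \<P>" "\<tau> \<in> \<P>" "\<sigma> \<noteq> \<tau>"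
    then obtain i where i: "\<sigma> i \<noteq> \<tau> i" by auto
    then have "i \<in> {1..n}"
      using \<open>\<sigma> \<in> \<P>\<close> \<open>\<tau> \<in> \<P>\<close> unfolding \<P>_def mem_Collect_eq by (metis permutes_not_in)
    moreover have "J (\<sigma> i) \<inter> J (\<tau> i) = {}"
    proof (rule equals0I)
      fix x assume "x \<in> J (\<sigma> i) \<inter> J (\<tau> i)"
      then show False using J_apart[OF _ _ i, of x x] n by auto
    qed
    ultimately have "\<not> (\<xi> i \<omega> \<in> J (\<sigma> i) \<and> \<xi> i \<omega> \<in> J (\<tau> i))" "i \<in> {1..n}" for \<omega>
      by blast+
    then show "E \<sigma> \<inter> E \<tau> = {}" unfolding disjoint_iff E by blast
  qed
  have "(\<Union>\<sigma>\<in>\<P>. E \<sigma>) \<subseteq> {\<omega>\<in>space M. cover_count \<omega> \<ge> n}"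
  proof safe
    fix \<sigma> \<omega> assume \<sigma>: "\<sigma> \<in> \<P>" and "\<omega> \<in> E \<sigma>"
    then have \<omega>: "\<omega> \<in> space M" "N \<omega> = n" "\<And>i. i \<in> {1..n} \<Longrightarrow> \<xi> i \<omega> \<in> J (\<sigma> i)"
      "\<And>i. i \<in> {1..n} \<Longrightarrow> R i \<omega> \<in> {h / 2..h}" by (auto simp: E)
    show "\<omega> \<in> space M" by fact
    have "cover_number (\<lambda>i. \<xi> i \<omega>) (\<lambda>i. R i \<omega>) n \<ge> n"
    proof (rule cover_number_ge_if_centres_isolated)
      fix i assume i: "i \<in> {1..n}"
      have \<sigma>i: "\<sigma> i \<in> {1..n}" using \<sigma> i permutes_in_image by (fastforce simp: \<P>_def)
      show "\<xi> i \<omega> \<in> {0..1}" using \<omega>(3)[OF i] J_unit[OF \<sigma>i] by auto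
      show "R i \<omega> \<ge> 0" using \<omega>(4)[OF i] h by auto
    next
      fix i j assume ij: "i \<in> {1..n}" "j \<in> {1..n}" "i \<noteq> j"
      then have "\<sigma> i \<noteq> \<sigma> j" using \<sigma> permutes_inj by (fastforce simp: \<P>_def inj_def)
      then have "1 / (2 * real n) \<le> \<bar>\<xi> i \<omega> - \<xi> j \<omega>\<bar>" using J_apart \<omega>(3) ij by blast
      then show "\<bar>\<xi> i \<omega> - \<xi> j \<omega>\<bar> > R j \<omega>" using \<omega>(4)[OF ij(2)] h by auto
    qed
    then show "cover_count \<omega> \<ge> n" using \<omega>(2) by simp
  qed
  then have "prob (\<Union>\<sigma>\<in>\<P>. E \<sigma>) \<le> prob {\<omega>\<in>space M. cover_count \<omega> \<ge> n}"
    by (rule finite_measure_mono[OF _ cover_count_event])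
  moreover have "prob (\<Union>\<sigma>\<in>\<P>. E \<sigma>) = (\<Sum>\<sigma>\<in>\<P>. prob (E \<sigma>))"
    using E_sets disjoint by (intro finite_measure_finite_Union[OF fin]) auto
  moreover have "(\<Sum>\<sigma>\<in>\<P>. (1 / (2 * real n)) ^ n * (q ^ n * pmf (poisson_pmf rate) n)) \<le> (\<Sum>\<sigma>\<in>\<P>. prob (E \<sigma>))"
    by (intro sum_mono prob_E)
  moreover have "(\<Sum>\<sigma>\<in>\<P>. (1 / (2 * real n)) ^ n * (q ^ n * pmf (poisson_pmf rate) n)) =
      exp (- rate) * (rate * q / (2 * real n)) ^ n"
  proof -
    have "(rate * q / (2 * real n)) ^ n = rate ^ n * q ^ n * (1 / (2 * real n)) ^ n"
      unfolding power_mult_distrib[symmetric] by simp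
    then show ?thesis by (simp add: card pmf_poisson[OF rate_pos])
  qed
  ultimately show ?thesis by linarith
qed

section \<open>Radii with a power-law density at zero\<close>

text \<open>
  Restricting to a dyadic interval keeps the density comparable to the constant \<open>h powr (\<alpha> - 1)\<close>, which
  loses only a constant factor and replaces integration of the power by multiplication with the length
  \<open>h / 2\<close>.
\<close>

lemma prob_radius_dyadic_ge:
  assumes "i \<ge> 1" "0 < h" "h < \<delta>" "c > 0"
    and density: "\<And>z. 0 < z \<Longrightarrow> z < \<delta> \<Longrightarrow> c * z powr (\<alpha> - 1) \<le> p z"
  shows "prob {\<omega>\<in>space M. R i \<omega> \<in> {h / 2..h}} \<ge> c * min 1 (2 powr (1 - \<alpha>)) / 2 * h powr \<alpha>"
proof -
  define \<kappa> where "\<kappa> = min 1 (2 powr (1 - \<alpha>))"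
  have "\<kappa> > 0" by (simp add: \<kappa>_def)
  have "ennreal (c * \<kappa> / 2 * h powr \<alpha>) = ennreal (c * \<kappa> * h powr (\<alpha> - 1)) * ennreal (h / 2)"
    using assms \<open>\<kappa> > 0\<close> by (simp add: ennreal_mult'[symmetric] powr_diff)
  also have "\<dots> = (\<integral>\<^sup>+z. ennreal (c * \<kappa> * h powr (\<alpha> - 1)) * indicator {h / 2..h} z \<partial>lborel)"
    using assms by (simp add: nn_integral_cmult)
  also have "\<dots> \<le> (\<integral>\<^sup>+z. ennreal (p z) * indicator {h / 2..h} z \<partial>lborel)"
  proof (rule nn_integral_mono)
    fix z
    show "ennreal (c * \<kappa> * h powr (\<alpha> - 1)) * indicator {h / 2..h} z \<le> ennreal (p z) * indicator {h / 2..h} z"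
    proof (cases "z \<in> {h / 2..h}")
      case True
      then have "c * (\<kappa> * h powr (\<alpha> - 1)) \<le> c * z powr (\<alpha> - 1)"
        using powr_ge_on_dyadic_interval[of h z "\<alpha> - 1"] assms
        by (intro mult_left_mono) (auto simp: \<kappa>_def)
      also have "\<dots> \<le> p z" using True assms by (intro density) auto
      finally show ?thesis by (intro mult_right_mono ennreal_leI) (auto simp: mult.assoc)
    qed auto
  qed
  also have "\<dots> = emeasure M (R i -` {h / 2..h} \<inter> space M)"
    by (rule distributed_emeasure[symmetric, OF radii[OF \<open>i \<ge> 1\<close>]]) auto
  also have "R i -` {h / 2..h} \<inter> space M = {\<omega>\<in>space M. R i \<omega> \<in> {h / 2..h}}" by auto
  finally have "ennreal (c * \<kappa> / 2 * h powr \<alpha>) \<le> ennreal (prob {\<omega>\<in>space M. R i \<omega> \<in> {h / 2..h}})"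
    by (simp only: emeasure_eq_measure)
  then have "c * \<kappa> / 2 * h powr \<alpha> \<le> prob {\<omega>\<in>space M. R i \<omega> \<in> {h / 2..h}}"
    by (subst (asm) ennreal_le_iff) auto
  then show ?thesis by (simp only: \<kappa>_def)
qed

text \<open>
  Radii below \<open>\<eta>\<close> contribute at most a Gamma integral, of the exact order \<open>s powr - \<alpha>\<close>.  The others
  contribute at most \<open>exp (- s * \<eta>)\<close>, since \<open>\<eta> \<le> 1\<close> keeps \<open>min z 1 \<ge> \<eta>\<close>; this is absorbed into the same
  order.
\<close>

lemma laplace_transform_radius_le:
  assumes "i \<ge> 1" "s > 0" "\<alpha> > 0" "0 < \<eta>" "\<eta> \<le> 1" "C > 0"
    and density: "\<And>z. 0 < z \<Longrightarrow> z < \<eta> \<Longrightarrow> p z \<le> C * z powr (\<alpha> - 1)"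
  shows "(\<integral>\<^sup>+\<omega>. ennreal (exp (- s * min (R i \<omega>) 1)) \<partial>M)
    \<le> ennreal ((C * Gamma \<alpha> + (\<alpha> / \<eta>) powr \<alpha>) * s powr - \<alpha>)"
proof -
  let ?g = "\<lambda>z. indicator {0..} z * z powr (\<alpha> - 1) / exp (s * z)"
  have [measurable]: "(\<lambda>z. ennreal (p z)) \<in> borel_measurable lborel"
    using distributed_borel_measurable[OF radii[OF \<open>i \<ge> 1\<close>]] .
  have total: "(\<integral>\<^sup>+z. ennreal (p z) \<partial>lborel) = 1"
    using distributed_nn_integral[OF radii[OF \<open>i \<ge> 1\<close>], of "\<lambda>_. 1"] by (simp add: emeasure_space_1)
  have "(\<integral>\<^sup>+\<omega>. ennreal (exp (- s * min (R i \<omega>) 1)) \<partial>M) =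
      (\<integral>\<^sup>+z. ennreal (p z) * ennreal (exp (- s * min z 1)) \<partial>lborel)"
    by (rule distributed_nn_integral[symmetric, OF radii[OF \<open>i \<ge> 1\<close>]]) measurable
  also have "\<dots> \<le> (\<integral>\<^sup>+z. ennreal C * ennreal (?g z) + ennreal (exp (- (s * \<eta>))) * ennreal (p z) \<partial>lborel)"
  proof (rule nn_integral_mono)
    fix z :: real
    consider "z \<le> 0" | "0 < z" "z < \<eta>" | "\<eta> \<le> z" by linarith
    then show "ennreal (p z) * ennreal (exp (- s * min z 1)) \<le>
        ennreal C * ennreal (?g z) + ennreal (exp (- (s * \<eta>))) * ennreal (p z)"
    proof cases
      case 1
      then show ?thesis by (simp add: density_support)
    next
      case 2
      have "ennreal (p z) * ennreal (exp (- s * min z 1))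
          \<le> ennreal (C * z powr (\<alpha> - 1)) * ennreal (exp (- s * min z 1))"
        using density[OF 2] by (intro mult_right_mono ennreal_leI) auto
      also have "\<dots> = ennreal C * ennreal (?g z)"
        using 2 assms by (simp add: ennreal_mult'[symmetric] exp_minus field_simps)
      finally show ?thesis by (rule order_trans) simp
    next
      case 3
      then have "exp (- s * min z 1) \<le> exp (- (s * \<eta>))" using assms by auto
      then have "ennreal (p z) * ennreal (exp (- s * min z 1)) \<le> ennreal (p z) * ennreal (exp (- (s * \<eta>)))"
        by (intro mult_left_mono ennreal_leI) auto
      also have "\<dots> \<le> ennreal C * ennreal (?g z) + ennreal (exp (- (s * \<eta>))) * ennreal (p z)"
        by (simp add: mult.commute)
      finally show ?thesis .
    qed
  qed
  also have "\<dots> = ennreal C * ennreal (Gamma \<alpha> * s powr - \<alpha>) + ennreal (exp (- (s * \<eta>)))"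
    by (subst nn_integral_add) (auto simp: nn_integral_cmult total Gamma_nn_integral_scaled[OF assms(3,2)])
  also have "\<dots> = ennreal (C * (Gamma \<alpha> * s powr - \<alpha>) + exp (- (s * \<eta>)))"
    using assms Gamma_real_pos[of \<alpha>]
    by (simp add: ennreal_mult'[symmetric] ennreal_plus[symmetric] del: ennreal_plus)
  also have "\<dots> \<le> ennreal ((C * Gamma \<alpha> + (\<alpha> / \<eta>) powr \<alpha>) * s powr - \<alpha>)"
  proof (rule ennreal_leI)
    have "exp (- (s * \<eta>)) \<le> (\<alpha> / (s * \<eta>)) powr \<alpha>" using assms by (intro exp_minus_le_powr) auto
    also have "\<dots> = (\<alpha> / \<eta>) powr \<alpha> * s powr - \<alpha>"
      using assms by (simp add: powr_divide powr_mult powr_minus_divide)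
    finally show "C * (Gamma \<alpha> * s powr - \<alpha>) + exp (- (s * \<eta>)) \<le> (C * Gamma \<alpha> + (\<alpha> / \<eta>) powr \<alpha>) * s powr - \<alpha>"
      by (simp add: algebra_simps)
  qed
  finally show ?thesis .
qed

end

section \<open>Logarithmic asymptotics of the tail\<close>

text \<open>
  Both bounds are used at the scale \<open>1 / n\<close>, with \<open>s = n\<close> in the upper and \<open>h = 1 / (4 n)\<close> in the lower
  one.  With \<open>n! \<ge> (n / e) ^ n\<close> they take the common form \<open>exp (O(n)) * (n powr - (1 + \<alpha>)) ^ n\<close>.
\<close>

theorem (in poisson_intervals) prob_cover_count_ge_asymptotics:
  assumes "\<alpha> > 0" and density_zero: "approx_at_zero p (\<lambda>z. z powr (\<alpha> - 1))"
  shows "\<exists>\<epsilon> :: nat \<Rightarrow> real. \<epsilon> \<longlonglongrightarrow> 0 \<and>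
    (\<forall>\<^sub>F n in sequentially. prob {\<omega>\<in>space M. cover_count \<omega> \<ge> n}
      = exp (- ((1 + \<alpha>) * real n * ln (real n) * (1 + \<epsilon> n))))"
proof -
  obtain c C \<delta> where c: "c > 0" "C > 0" "\<delta> > 0"
    and density: "\<And>z. 0 < z \<Longrightarrow> z < \<delta> \<Longrightarrow> c * z powr (\<alpha> - 1) \<le> p z"
      "\<And>z. 0 < z \<Longrightarrow> z < \<delta> \<Longrightarrow> p z \<le> C * z powr (\<alpha> - 1)"
    by (rule approx_at_zero_powr_bounds[OF density_zero]) blast
  define \<eta> where "\<eta> = min \<delta> 1"
  define D where "D = C * Gamma \<alpha> + (\<alpha> / \<eta>) powr \<alpha>"
  (* The factor (1 / 4) powr \<alpha> comes from h = 1 / (4 n). *)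
  define k where "k = c * min 1 (2 powr (1 - \<alpha>)) / 2 * (1 / 4) powr \<alpha>"
  define b where "b = rate * k / 2"
  have \<eta>: "0 < \<eta>" "\<eta> \<le> 1" using c by (auto simp: \<eta>_def)
  have D: "D > 0" using c assms(1) \<eta> Gamma_real_pos[of \<alpha>] by (auto simp: D_def intro!: add_pos_nonneg)
  have k: "k > 0" using c by (auto simp: k_def intro!: mult_pos_pos)
  have b: "b > 0" using k rate_pos by (simp add: b_def)
  (* A collects the rates of all factors exp (O(n)): b is the constant per interval in the lower bound,
     D * rate the one in the upper bound, and 3 = 2 + 1 stems from exp (2 n) and from n! >= (n / e) ^ n. *)
  define A where "A = \<bar>ln b\<bar> + rate + \<bar>ln (D * rate)\<bar> + 3"
  have A: "A * x = \<bar>ln b\<bar> * x + rate * x + \<bar>ln (D * rate)\<bar> * x + 3 * x" for x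
    by (simp add: A_def algebra_simps)
  have "\<forall>\<^sub>F n in sequentially. exp (- ((1 + \<alpha>) * real n * ln (real n)) - A * real n)
      \<le> prob {\<omega>\<in>space M. cover_count \<omega> \<ge> n}"
    using eventually_gt_at_top[of "nat \<lceil>1 / \<delta>\<rceil>"]
  proof eventually_elim
    case (elim n)
    then have n: "n \<ge> 1" "real n > 1 / \<delta>" by linarith+
    have h: "1 / (4 * real n) < \<delta>"
    proof -
      have "1 < \<delta> * real n" using n c by (simp add: divide_less_eq mult.commute)
      also have "\<dots> \<le> \<delta> * (4 * real n)" using c by simp
      finally show ?thesis using n by (simp add: divide_less_eq)
    qed
    have "prob {\<omega>\<in>space M. cover_count \<omega> \<ge> n}
        \<ge> exp (- rate) * (rate * (k * real n powr - \<alpha>) / (2 * real n)) ^ n"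
    proof (rule prob_cover_count_ge_lower[where h="1 / (4 * real n)"])
      fix i :: nat assume "i \<ge> 1"
      have "k * real n powr - \<alpha> = c * min 1 (2 powr (1 - \<alpha>)) / 2 * (1 / (4 * real n)) powr \<alpha>"
        using n by (simp add: k_def powr_divide powr_mult powr_minus_divide)
      also have "\<dots> \<le> prob {\<omega>\<in>space M. R i \<omega> \<in> {1 / (4 * real n) / 2..1 / (4 * real n)}}"
        by (rule prob_radius_dyadic_ge[OF \<open>i \<ge> 1\<close> _ h c(1) density(1)]) (use n in auto)
      finally show "k * real n powr - \<alpha> \<le> prob {\<omega>\<in>space M. R i \<omega> \<in> {1 / (4 * real n) / 2..1 / (4 * real n)}}" .
    next
      show "1 / (4 * real n) < 1 / (2 * real n)" using n by (intro divide_strict_left_mono) auto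
    qed (use n k in auto)
    moreover have "rate * (k * real n powr - \<alpha>) / (2 * real n) = b * real n powr (- (1 + \<alpha>))"
      using n powr_minus_one_plus[of "real n" \<alpha>] by (simp add: b_def)
    ultimately have "exp (- rate + (real n * ln b + - (1 + \<alpha>) * real n * ln (real n)))
        \<le> prob {\<omega>\<in>space M. cover_count \<omega> \<ge> n}"
      by (simp only: powr_power_eq_exp[OF b n(1)] exp_add[of "- rate"])
    moreover have "exp (- ((1 + \<alpha>) * real n * ln (real n)) - A * real n)
        \<le> exp (- rate + (real n * ln b + - (1 + \<alpha>) * real n * ln (real n)))"
    proof -
      have "rate \<le> rate * real n" using n rate_pos by simp
      moreover have "- (\<bar>ln b\<bar> * real n) \<le> ln b * real n"
        by (simp only: mult_minus_left[symmetric]) (intro mult_right_mono, auto)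
      moreover have "0 \<le> \<bar>ln (D * rate)\<bar> * real n" by simp
      moreover have "0 \<le> real n" by simp
      ultimately show ?thesis unfolding exp_le_cancel_iff A by argo
    qed
    ultimately show ?case by linarith
  qed
  moreover have "\<forall>\<^sub>F n in sequentially. prob {\<omega>\<in>space M. cover_count \<omega> \<ge> n}
      \<le> exp (- ((1 + \<alpha>) * real n * ln (real n)) + A * real n)"
    using eventually_ge_at_top[of 1]
  proof eventually_elim
    case (elim n)
    have "prob {\<omega>\<in>space M. cover_count \<omega> \<ge> n}
        \<le> exp (2 * real n) * (D * real n powr - \<alpha>) ^ n * (rate ^ n / fact n)"
    proof (rule prob_cover_count_ge_upper[OF elim])
      fix i :: nat assume "i \<ge> 1"
      show "(\<integral>\<^sup>+\<omega>. ennreal (exp (- real n * min (R i \<omega>) 1)) \<partial>M) \<le> ennreal (D * real n powr - \<alpha>)"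
        unfolding D_def using elim density(2)
        by (intro laplace_transform_radius_le[OF \<open>i \<ge> 1\<close> _ assms(1) \<eta> c(2)]) (auto simp: \<eta>_def)
    qed (use D in auto)
    also have "\<dots> \<le> exp (2 * real n) * (D * real n powr - \<alpha>) ^ n * (rate ^ n * (exp (real n) * (1 / real n) ^ n))"
    proof (rule mult_left_mono)
      have "1 / fact n \<le> exp (real n) * (1 / real n) ^ n"
        using power_self_le_fact_mult_exp[of n] elim
        by (simp add: power_one_over pos_divide_le_eq pos_le_divide_eq mult.commute)
      then have "rate ^ n * (1 / fact n) \<le> rate ^ n * (exp (real n) * (1 / real n) ^ n)"
        using rate_pos by (intro mult_left_mono) auto
      then show "rate ^ n / fact n \<le> rate ^ n * (exp (real n) * (1 / real n) ^ n)" by simp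
    qed (use D in auto)
    also have "\<dots> = exp (3 * real n) * (D * rate * real n powr - (1 + \<alpha>)) ^ n"
    proof -
      have "D * rate * real n powr - (1 + \<alpha>) = D * real n powr - \<alpha> * (rate * (1 / real n))"
        using elim powr_minus_one_plus[of "real n" \<alpha>] by simp
      moreover have "exp (3 * real n) = exp (2 * real n) * exp (real n)" by (simp add: exp_add[symmetric])
      ultimately show ?thesis by (simp only: power_mult_distrib) (simp only: mult_ac)
    qed
    also have "\<dots> = exp (3 * real n + (real n * ln (D * rate) + - (1 + \<alpha>) * real n * ln (real n)))"
      by (simp only: powr_power_eq_exp[OF mult_pos_pos[OF D rate_pos] elim] exp_add[of "3 * real n"])
    also have "\<dots> \<le> exp (- ((1 + \<alpha>) * real n * ln (real n)) + A * real n)"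
    proof -
      have "0 \<le> rate * real n" using rate_pos by simp
      moreover have "ln (D * rate) * real n \<le> \<bar>ln (D * rate)\<bar> * real n" by (intro mult_right_mono) auto
      moreover have "0 \<le> \<bar>ln b\<bar> * real n" by simp
      moreover have "0 \<le> real n" by simp
      ultimately show ?thesis unfolding exp_le_cancel_iff A by argo
    qed
    finally show ?case .
  qed
  ultimately show ?thesis using assms(1) by (intro log_asymptotics_of_exp_bounds) auto
qed

theorem theorem1:
  fixes M :: "'a measure"
    and \<xi> R :: "nat \<Rightarrow> 'a \<Rightarrow> real"
    and N :: "'a \<Rightarrow> nat"
    and p :: "real \<Rightarrow> real"
    and rate \<alpha> :: real
  assumes "prob_space M"
    and "rate > 0"
    and "\<alpha> > 0"
    and independent: "prob_space.indep_vars M (\<lambda>_. borel)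
           (case_sum \<xi> (case_sum R (\<lambda>_::unit. \<lambda>\<omega>. real (N \<omega>))))
           ({1..} <+> {1..} <+> {()})"
    and centres: "\<And>i. i \<ge> 1 \<Longrightarrow> distr M borel (\<xi> i) = uniform_measure lborel {0..1}"
    and radii: "\<And>i. i \<ge> 1 \<Longrightarrow> distributed M lborel (R i) (\<lambda>z. ennreal (p z))"
    and number: "N \<in> measurable M (count_space UNIV)"
           "distr M (count_space UNIV) N = measure_pmf (poisson_pmf rate)"
    and density_nonneg: "\<And>z. p z \<ge> 0"
    and density_support: "\<And>z. z \<le> 0 \<Longrightarrow> p z = 0"
    and density_zero: "approx_at_zero p (\<lambda>z. z powr (\<alpha> - 1))"
  shows "\<exists>\<epsilon> :: nat \<Rightarrow> real. \<epsilon> \<longlonglongrightarrow> 0 \<and>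
           (\<forall>\<^sub>F n in sequentially.
              measure M {\<omega> \<in> space M. cover_number (\<lambda>i. \<xi> i \<omega>) (\<lambda>i. R i \<omega>) (N \<omega>) \<ge> n}
                = exp (- ((1 + \<alpha>) * real n * ln (real n) * (1 + \<epsilon> n))))"
proof -
  interpret prob_space M by fact
  interpret poisson_intervals M \<xi> R N p rate
    by unfold_locales (fact assms)+
  show ?thesis by (rule prob_cover_count_ge_asymptotics) fact+
qed

end
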